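(* Let $k$ be an algebraically closed field of characteristic zero and $n\ge 1$. Every finite subgroup of the Cremona group $\mathrm{Cr}_n=\mathrm{Bir}(\mathbf A^n)$ which is conjugate in $\mathrm{Cr}_n$ to a subgroup of $\mathrm{GL}_n(k)$ is nontrivially self-compressible.
   Context: $\mathrm{Cr}_n$ is the group of birational self-maps of $\mathbf A^n$ over $k$, and $\mathrm{GL}_n(k)\subset\mathrm{Cr}_n$ is the subgroup of invertible linear maps. A finite subgroup $G\subset\mathrm{Cr}_n$ is nontrivially self-compressible if there exists a dominant rational map $\varphi\colon\mathbf A^n\dashrightarrow\mathbf A^n$ which is not a birational isomorphism and satisfies $\varphi\circ g=g\circ\varphi$ for all $g\in G$. *)

theory Defs
  imports "HOL-Analysis.Analysis" "HOL-Algebra.Coset"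
begin

section \<open>Affine space, its Zariski topology and regular functions\<close>

text \<open>
  The closed points of affine \<open>n\<close>-space over an algebraically closed field \<open>'a\<close> are the elements of
  \<open>'a ^ 'n\<close>, with \<open>n = CARD('n) \<ge> 1\<close>.  As the ground field is infinite, polynomials
  and polynomial functions are the same thing.
\<close>

inductive poly_fun :: "('a::field ^ 'n \<Rightarrow> 'a) \<Rightarrow> bool" where
  const: "poly_fun (\<lambda>x. c)"
| coord: "poly_fun (\<lambda>x. x $ i)"
| add: "poly_fun p \<Longrightarrow> poly_fun q \<Longrightarrow> poly_fun (\<lambda>x. p x + q x)"
| mult: "poly_fun p \<Longrightarrow> poly_fun q \<Longrightarrow> poly_fun (\<lambda>x. p x * q x)"

text \<open>Closed sets are the common zero sets of families of polynomials.\<close>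

definition zariski :: "('a::field ^ 'n) topology" where
  "zariski = topology (\<lambda>U. \<exists>F. (\<forall>p\<in>F. poly_fun p) \<and> U = - {x. \<forall>p\<in>F. p x = 0})"

definition regular_on :: "('a::field ^ 'n) set \<Rightarrow> ('a ^ 'n \<Rightarrow> 'a) \<Rightarrow> bool" where
  "regular_on U f \<longleftrightarrow>
    (\<forall>x\<in>U. \<exists>V p q. openin zariski V \<and> x \<in> V \<and> V \<subseteq> U \<and> poly_fun p \<and> poly_fun q \<and>
      (\<forall>y\<in>V. q y \<noteq> 0 \<and> f y = p y / q y))"

definition morphism_on :: "('a::field ^ 'n) set \<Rightarrow> ('a ^ 'n \<Rightarrow> 'a ^ 'n) \<Rightarrow> bool" where
  "morphism_on U f \<longleftrightarrow> (\<forall>i. regular_on U (\<lambda>x. f x $ i))"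

lemma poly_fun_diff: "poly_fun p \<Longrightarrow> poly_fun q \<Longrightarrow> poly_fun (\<lambda>x. p x - q x)"
  using poly_fun.add[OF _ poly_fun.mult[OF poly_fun.const[of "-1"]], of p q] by simp

lemma poly_fun_sum: "(\<And>i. i \<in> A \<Longrightarrow> poly_fun (p i)) \<Longrightarrow> poly_fun (\<lambda>x. \<Sum>i\<in>A. p i x)"
proof (induction A rule: infinite_finite_induct)
  case (insert i A)
  then show ?case by (simp add: poly_fun.add)
qed (auto intro: poly_fun.const)

lemma istopology_zariski:
  "istopology (\<lambda>U::('a::field ^ 'n) set. \<exists>F. (\<forall>p\<in>F. poly_fun p) \<and> U = - {x. \<forall>p\<in>F. p x = 0})"
  unfolding istopology_def
proof (intro conjI allI impI)
  fix S T :: "('a ^ 'n) set"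
  assume "\<exists>F. (\<forall>p\<in>F. poly_fun p) \<and> S = - {x. \<forall>p\<in>F. p x = 0}"
    and "\<exists>F. (\<forall>p\<in>F. poly_fun p) \<and> T = - {x. \<forall>p\<in>F. p x = 0}"
  then obtain F G where "\<forall>p\<in>F. poly_fun p" "S = - {x. \<forall>p\<in>F. p x = 0}"
    and "\<forall>p\<in>G. poly_fun p" "T = - {x. \<forall>p\<in>G. p x = 0}" by blast
  note F = this
  define H where "H = {\<lambda>x. p x * q x | p q. p \<in> F \<and> q \<in> G}"
  have HP: "\<forall>h\<in>H. poly_fun h" using F(1,3) unfolding H_def by (auto intro: poly_fun.mult)
  have HS: "S \<inter> T = - {x. \<forall>h\<in>H. h x = 0}"
  proof (intro equalityI subsetI)
    fix x assume "x \<in> S \<inter> T"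
    then obtain p q where pq: "p \<in> F" "p x \<noteq> 0" "q \<in> G" "q x \<noteq> 0" using F(2,4) by auto
    then have H: "(\<lambda>x. p x * q x) \<in> H" unfolding H_def by blast
    have "\<not> (\<forall>h\<in>H. h x = 0)"
    proof
      assume "\<forall>h\<in>H. h x = 0"
      from bspec[OF this H] show False using pq by simp
    qed
    then show "x \<in> - {x. \<forall>h\<in>H. h x = 0}" by simp
  next
    fix x assume "x \<in> - {x. \<forall>h\<in>H. h x = 0}"
    then obtain p q where "p \<in> F" "q \<in> G" "p x * q x \<noteq> 0" unfolding H_def by auto
    then show "x \<in> S \<inter> T" using F(2,4) by auto
  qed
  show "\<exists>F. (\<forall>p\<in>F. poly_fun p) \<and> S \<inter> T = - {x. \<forall>p\<in>F. p x = 0}"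
    by (rule exI[of _ H]) (rule conjI[OF HP HS])
next
  fix K :: "('a ^ 'n) set set"
  assume "\<forall>U\<in>K. \<exists>F. (\<forall>p\<in>F. poly_fun p) \<and> U = - {x. \<forall>p\<in>F. p x = 0}"
  then have "\<forall>U\<in>K. \<exists>F. (\<forall>p\<in>F. poly_fun p) \<and> U = - {x. \<forall>p\<in>F. p x = 0}" .
  from bchoice[OF this] obtain F where F: "\<And>U. U \<in> K \<Longrightarrow> (\<forall>p\<in>F U. poly_fun p) \<and> U = - {x. \<forall>p\<in>F U. p x = 0}"
    by (elim exE) (rule that, erule bspec)
  have "\<Union>K = (\<Union>U\<in>K. - {x. \<forall>p\<in>F U. p x = 0})" 
    using F by (subst image_ident[symmetric], intro SUP_cong) auto
  also have "\<dots> = - {x. \<forall>p\<in>(\<Union>U\<in>K. F U). p x = 0}" by blast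
  finally have KS: "\<Union>K = - {x. \<forall>p\<in>(\<Union>U\<in>K. F U). p x = 0}" .
  have KP: "\<forall>p\<in>(\<Union>U\<in>K. F U). poly_fun p" using F by blast
  show "\<exists>F. (\<forall>p\<in>F. poly_fun p) \<and> \<Union>K = - {x. \<forall>p\<in>F. p x = 0}"
    by (rule exI[of _ "\<Union>U\<in>K. F U"]) (rule conjI[OF KP KS])
qed

lemma openin_zariski:
  "openin zariski U \<longleftrightarrow> (\<exists>F. (\<forall>p\<in>F. poly_fun p) \<and> U = - {x. \<forall>p\<in>F. p x = 0})"
  unfolding zariski_def by (simp add: topology_inverse'[OF istopology_zariski])

lemma openin_zariski_local:
  "openin zariski U \<longleftrightarrow> (\<forall>x\<in>U. \<exists>h. poly_fun h \<and> h x \<noteq> 0 \<and> {y. h y \<noteq> 0} \<subseteq> U)"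
proof
  assume "openin zariski U"
  then obtain F where F: "\<forall>p\<in>F. poly_fun p" "U = - {x. \<forall>p\<in>F. p x = 0}"
    unfolding openin_zariski by blast
  show "\<forall>x\<in>U. \<exists>h. poly_fun h \<and> h x \<noteq> 0 \<and> {y. h y \<noteq> 0} \<subseteq> U"
  proof
    fix x assume "x \<in> U"
    then obtain h where h: "h \<in> F" "h x \<noteq> 0" using F(2) by auto
    then have "{y. h y \<noteq> 0} \<subseteq> U" using F(2) by auto
    then show "\<exists>h. poly_fun h \<and> h x \<noteq> 0 \<and> {y. h y \<noteq> 0} \<subseteq> U" using h F(1) by blast
  qed
next
  assume U: "\<forall>x\<in>U. \<exists>h. poly_fun h \<and> h x \<noteq> 0 \<and> {y. h y \<noteq> 0} \<subseteq> U"
  define F where "F = {h. poly_fun h \<and> {y. h y \<noteq> 0} \<subseteq> U}"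
  have "x \<in> U \<longleftrightarrow> (\<exists>h\<in>F. h x \<noteq> 0)" for x
    using U unfolding F_def by blast
  then have FS: "U = - {x. \<forall>p\<in>F. p x = 0}" by auto
  have FP: "\<forall>p\<in>F. poly_fun p" by (simp add: F_def)
  show "openin zariski U"
    unfolding openin_zariski by (rule exI[of _ F]) (rule conjI[OF FP FS])
qed

lemma openin_zariski_UNIV [simp]: "openin zariski UNIV"
  unfolding openin_zariski_local
  by (intro ballI exI[of _ "\<lambda>_. 1"]) (simp add: poly_fun.const)

lemma topspace_zariski [simp]: "topspace zariski = UNIV"
  using openin_subset[OF openin_zariski_UNIV] by blast

lemma zariski_dense_iff:
  "zariski closure_of S = UNIV \<longleftrightarrow> (\<forall>W. openin zariski W \<and> W \<noteq> {} \<longrightarrow> S \<inter> W \<noteq> {})"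
  using dense_intersects_open[of zariski S] by simp

lemma zariski_denseD:
  assumes "zariski closure_of (f ` U) = UNIV" "openin zariski W" "W \<noteq> {}"
  obtains x where "x \<in> U" "f x \<in> W"
proof -
  have "f ` U \<inter> W \<noteq> {}" using assms zariski_dense_iff by metis
  then show thesis using that by auto
qed

lemma openin_zariski_poly: "poly_fun h \<Longrightarrow> openin zariski {y. h y \<noteq> 0}"
  unfolding openin_zariski_local by blast

lemma infinite_UNIV_alg_closed: "infinite (UNIV :: 'a::alg_closed_field set)"
proof
  assume fin: "finite (UNIV :: 'a set)"
  define P where "P = (\<Prod>a\<in>(UNIV::'a set). [:-a, 1:])"
  have P0: "poly P x = 0" for x
    unfolding P_def poly_prod using fin by (auto simp: prod_zero_iff)
  have "degree P = (\<Sum>a\<in>(UNIV::'a set). degree [:-a, 1:])"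
    unfolding P_def by (rule degree_prod_eq_sum_degree) auto
  then have "degree P > 0" using fin by (simp add: card_gt_0_iff)
  then have "degree (P + 1) > 0"
    by (subst degree_add_eq_left) auto
  then obtain x where "poly (P + 1) x = 0" using alg_closed_imp_poly_has_root by blast
  then show False by (simp add: P0)
qed

lemma poly_fun_line:
  fixes p :: "'a::field ^ 'n \<Rightarrow> 'a"
  assumes "poly_fun p"
  shows "\<exists>P. \<forall>t. p (x + t *s (y - x)) = poly P t"
  using assms
proof induction
  case (const c)
  then show ?case by (intro exI[of _ "[:c:]"]) simp
next
  case (coord i)
  then show ?case by (intro exI[of _ "[:x $ i, y $ i - x $ i:]"]) (simp add: algebra_simps)
next
  case (add p q)
  then obtain P Q where "\<forall>t. p (x + t *s (y - x)) = poly P t" "\<forall>t. q (x + t *s (y - x)) = poly Q t"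
    by blast
  then show ?case by (intro exI[of _ "P + Q"]) simp
next
  case (mult p q)
  then obtain P Q where "\<forall>t. p (x + t *s (y - x)) = poly P t" "\<forall>t. q (x + t *s (y - x)) = poly Q t"
    by blast
  then show ?case by (intro exI[of _ "P * Q"]) simp
qed

lemma zariski_irreducible:
  fixes U V :: "('a::alg_closed_field ^ 'n) set"
  assumes "openin zariski U" "U \<noteq> {}" "openin zariski V" "V \<noteq> {}"
  shows "U \<inter> V \<noteq> {}"
proof -
  obtain x y p q where x: "x \<in> U" "poly_fun p" "p x \<noteq> 0" "{z. p z \<noteq> 0} \<subseteq> U"
    and y: "y \<in> V" "poly_fun q" "q y \<noteq> 0" "{z. q z \<noteq> 0} \<subseteq> V"
    using assms unfolding openin_zariski_local by blast
  obtain P Q where P: "\<forall>t. p (x + t *s (y - x)) = poly P t"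
    and Q: "\<forall>t. q (x + t *s (y - x)) = poly Q t"
    using poly_fun_line[OF x(2), of x y] poly_fun_line[OF y(2), of x y] by blast
  have "poly P 0 \<noteq> 0" using P[rule_format, of 0] x(3) by simp
  moreover have "poly Q 1 \<noteq> 0" using Q[rule_format, of 1] y(3) by simp
  ultimately have "P * Q \<noteq> 0" by auto
  then have "finite {t. poly (P * Q) t = 0}" by (rule poly_roots_finite)
  then obtain t where "poly (P * Q) t \<noteq> 0"
    using infinite_UNIV_alg_closed[where 'a='a] by (metis (mono_tags, lifting) UNIV_eq_I mem_Collect_eq)
  then have "p (x + t *s (y - x)) \<noteq> 0" "q (x + t *s (y - x)) \<noteq> 0" using P Q by auto
  then have "x + t *s (y - x) \<in> U" "x + t *s (y - x) \<in> V"
    using subsetD[OF x(4)] subsetD[OF y(4)] by simp_all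
  then have "x + t *s (y - x) \<in> U \<inter> V" by (rule IntI)
  then show ?thesis by (metis empty_iff)
qed

lemma regular_onE:
  assumes "regular_on U f" "x \<in> U"
  obtains V p q where "openin zariski V" "x \<in> V" "V \<subseteq> U" "poly_fun p" "poly_fun q"
    "\<And>y. y \<in> V \<Longrightarrow> q y \<noteq> 0" "\<And>y. y \<in> V \<Longrightarrow> f y = p y / q y"
proof -
  from assms(1)[unfolded regular_on_def, rule_format, OF assms(2)]
  obtain V p q where "openin zariski V \<and> x \<in> V \<and> V \<subseteq> U \<and> poly_fun p \<and> poly_fun q \<and>
      (\<forall>y\<in>V. q y \<noteq> 0 \<and> f y = p y / q y)"
    by (elim exE) (rule that)
  then show thesis by (intro that[of V p q]) simp_all
qed

lemma regular_onI:
  assumes "\<And>x. x \<in> U \<Longrightarrow> \<exists>V. openin zariski V \<and> x \<in> V \<and> V \<subseteq> U \<and> regular_on V f"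
  shows "regular_on U f"
  unfolding regular_on_def
proof
  fix x assume "x \<in> U"
  from assms[OF this] obtain V where V: "x \<in> V" "V \<subseteq> U" "regular_on V f" by (elim exE conjE) (rule that)
  obtain W p q where W: "openin zariski W" "x \<in> W" "W \<subseteq> V" "poly_fun p" "poly_fun q"
      "\<And>y. y \<in> W \<Longrightarrow> q y \<noteq> 0" "\<And>y. y \<in> W \<Longrightarrow> f y = p y / q y"
    by (rule regular_onE[OF V(3,1)]) (rule that)
  show "\<exists>V p q. openin zariski V \<and> x \<in> V \<and> V \<subseteq> U \<and> poly_fun p \<and> poly_fun q \<and>
      (\<forall>y\<in>V. q y \<noteq> 0 \<and> f y = p y / q y)"
    by (rule exI[of _ W], rule exI[of _ p], rule exI[of _ q])
      (simp add: W(1,2,4-7) order_trans[OF W(3) V(2)])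
qed

lemma regular_on_frac:
  assumes "openin zariski U" "poly_fun p" "poly_fun q"
    and "\<And>y. y \<in> U \<Longrightarrow> q y \<noteq> 0" "\<And>y. y \<in> U \<Longrightarrow> f y = p y / q y"
  shows "regular_on U f"
  unfolding regular_on_def
  by (rule ballI, rule exI[of _ U], rule exI[of _ p], rule exI[of _ q]) (simp add: assms)

lemma regular_on_subset:
  assumes "regular_on U f" "openin zariski V" "V \<subseteq> U"
  shows "regular_on V f"
proof (rule regular_onI)
  fix x assume x: "x \<in> V"
  then have "x \<in> U" using assms(3) by blast
  obtain W p q where W: "openin zariski W" "x \<in> W" "W \<subseteq> U" "poly_fun p" "poly_fun q"
      "\<And>y. y \<in> W \<Longrightarrow> q y \<noteq> 0" "\<And>y. y \<in> W \<Longrightarrow> f y = p y / q y"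
    by (rule regular_onE[OF assms(1) \<open>x \<in> U\<close>]) (rule that)
  have "regular_on (W \<inter> V) f"
    by (rule regular_on_frac[OF openin_Int[OF W(1) assms(2)] W(4,5)]) (simp_all add: W(6,7))
  then show "\<exists>T. openin zariski T \<and> x \<in> T \<and> T \<subseteq> V \<and> regular_on T f"
    using W(1,2) x assms(2) by (intro exI[of _ "W \<inter> V"]) (simp add: openin_Int)
qed

lemma regular_on_cong:
  assumes "regular_on U f" "\<And>x. x \<in> U \<Longrightarrow> f x = g x"
  shows "regular_on U g"
  unfolding regular_on_def
proof
  fix x assume x: "x \<in> U"
  obtain W p q where W: "openin zariski W" "x \<in> W" "W \<subseteq> U" "poly_fun p" "poly_fun q"
      "\<And>y. y \<in> W \<Longrightarrow> q y \<noteq> 0" "\<And>y. y \<in> W \<Longrightarrow> f y = p y / q y"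
    by (rule regular_onE[OF assms(1) x]) (rule that)
  have "g y = p y / q y" if "y \<in> W" for y
    using W(7)[OF that] assms(2)[OF subsetD[OF W(3) that]] by simp
  then show "\<exists>V p q. openin zariski V \<and> x \<in> V \<and> V \<subseteq> U \<and> poly_fun p \<and> poly_fun q \<and>
      (\<forall>y\<in>V. q y \<noteq> 0 \<and> g y = p y / q y)"
    by (intro exI[of _ W] exI[of _ p] exI[of _ q]) (simp add: W(1-6))
qed

lemma regular_on_poly: "openin zariski U \<Longrightarrow> poly_fun p \<Longrightarrow> regular_on U p"
  by (rule regular_on_frac[where q = "\<lambda>_. 1" and p = p]) (simp_all add: poly_fun.const)

lemma regular_on_binop:
  assumes "regular_on U f" "regular_on U g"
    and "\<And>V p q p' q'. openin zariski V \<Longrightarrow> V \<subseteq> U \<Longrightarrow>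
      poly_fun p \<Longrightarrow> poly_fun q \<Longrightarrow> poly_fun p' \<Longrightarrow> poly_fun q' \<Longrightarrow>
      (\<And>y. y \<in> V \<Longrightarrow> q y \<noteq> 0) \<Longrightarrow> (\<And>y. y \<in> V \<Longrightarrow> q' y \<noteq> 0) \<Longrightarrow>
      (\<And>y. y \<in> V \<Longrightarrow> f y = p y / q y) \<Longrightarrow> (\<And>y. y \<in> V \<Longrightarrow> g y = p' y / q' y) \<Longrightarrow>
      regular_on V h"
  shows "regular_on U h"
proof (rule regular_onI)
  fix x assume x: "x \<in> U"
  obtain V p q where V: "openin zariski V" "x \<in> V" "V \<subseteq> U" "poly_fun p" "poly_fun q"
      "\<And>y. y \<in> V \<Longrightarrow> q y \<noteq> 0" "\<And>y. y \<in> V \<Longrightarrow> f y = p y / q y"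
    by (rule regular_onE[OF assms(1) x]) (rule that)
  obtain V' p' q' where V': "openin zariski V'" "x \<in> V'" "V' \<subseteq> U" "poly_fun p'" "poly_fun q'"
      "\<And>y. y \<in> V' \<Longrightarrow> q' y \<noteq> 0" "\<And>y. y \<in> V' \<Longrightarrow> g y = p' y / q' y"
    by (rule regular_onE[OF assms(2) x]) (rule that)
  have VV: "openin zariski (V \<inter> V')" "V \<inter> V' \<subseteq> U" using V(1,3) V'(1) by auto
  have "regular_on (V \<inter> V') h"
    by (rule assms(3)[OF VV V(4,5) V'(4,5)]) (simp_all add: V(6,7) V'(6,7))
  then show "\<exists>T. openin zariski T \<and> x \<in> T \<and> T \<subseteq> U \<and> regular_on T h"
    using VV V(2) V'(2) by (intro exI[of _ "V \<inter> V'"]) simp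
qed

lemma regular_on_add:
  assumes "regular_on U f" "regular_on U g"
  shows "regular_on U (\<lambda>x. f x + g x)"
proof (rule regular_on_binop[OF assms])
  fix V p q p' q'
  assume *: "openin zariski V" "poly_fun p" "poly_fun q" "poly_fun p'" "poly_fun q'"
    "\<And>y. y \<in> V \<Longrightarrow> q y \<noteq> 0" "\<And>y. y \<in> V \<Longrightarrow> q' y \<noteq> 0"
    "\<And>y. y \<in> V \<Longrightarrow> f y = p y / q y" "\<And>y. y \<in> V \<Longrightarrow> g y = p' y / q' y"
  show "regular_on V (\<lambda>x. f x + g x)"
  proof (rule regular_on_frac[OF *(1)])
    show "poly_fun (\<lambda>y. p y * q' y + p' y * q y)" "poly_fun (\<lambda>y. q y * q' y)"
      by (intro poly_fun.add poly_fun.mult *(2-5))+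
  qed (simp_all add: *(6-9) add_frac_eq)
qed

lemma regular_on_diff:
  assumes "regular_on U f" "regular_on U g"
  shows "regular_on U (\<lambda>x. f x - g x)"
proof (rule regular_on_binop[OF assms])
  fix V p q p' q'
  assume *: "openin zariski V" "poly_fun p" "poly_fun q" "poly_fun p'" "poly_fun q'"
    "\<And>y. y \<in> V \<Longrightarrow> q y \<noteq> 0" "\<And>y. y \<in> V \<Longrightarrow> q' y \<noteq> 0"
    "\<And>y. y \<in> V \<Longrightarrow> f y = p y / q y" "\<And>y. y \<in> V \<Longrightarrow> g y = p' y / q' y"
  show "regular_on V (\<lambda>x. f x - g x)"
  proof (rule regular_on_frac[OF *(1)])
    show "poly_fun (\<lambda>y. p y * q' y - p' y * q y)" "poly_fun (\<lambda>y. q y * q' y)"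
      by (intro poly_fun_diff poly_fun.mult *(2-5))+
  qed (simp_all add: *(6-9) diff_frac_eq)
qed

lemma regular_on_mult:
  assumes "regular_on U f" "regular_on U g"
  shows "regular_on U (\<lambda>x. f x * g x)"
proof (rule regular_on_binop[OF assms])
  fix V p q p' q'
  assume *: "openin zariski V" "poly_fun p" "poly_fun q" "poly_fun p'" "poly_fun q'"
    "\<And>y. y \<in> V \<Longrightarrow> q y \<noteq> 0" "\<And>y. y \<in> V \<Longrightarrow> q' y \<noteq> 0"
    "\<And>y. y \<in> V \<Longrightarrow> f y = p y / q y" "\<And>y. y \<in> V \<Longrightarrow> g y = p' y / q' y"
  show "regular_on V (\<lambda>x. f x * g x)"
  proof (rule regular_on_frac[OF *(1)])
    show "poly_fun (\<lambda>y. p y * p' y)" "poly_fun (\<lambda>y. q y * q' y)"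
      by (intro poly_fun.mult *(2-5))+
  qed (simp_all add: *(6-9))
qed

lemma regular_on_divide:
  assumes "regular_on U f" "regular_on U g" "\<And>x. x \<in> U \<Longrightarrow> g x \<noteq> 0"
  shows "regular_on U (\<lambda>x. f x / g x)"
proof (rule regular_on_binop[OF assms(1,2)])
  fix V p q p' q'
  assume *: "openin zariski V" "V \<subseteq> U" "poly_fun p" "poly_fun q" "poly_fun p'" "poly_fun q'"
    "\<And>y. y \<in> V \<Longrightarrow> q y \<noteq> 0" "\<And>y. y \<in> V \<Longrightarrow> q' y \<noteq> 0"
    "\<And>y. y \<in> V \<Longrightarrow> f y = p y / q y" "\<And>y. y \<in> V \<Longrightarrow> g y = p' y / q' y"
  have p': "p' y \<noteq> 0" if "y \<in> V" for y
    using assms(3)[OF subsetD[OF *(2) that]] *(10)[OF that] by auto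
  show "regular_on V (\<lambda>x. f x / g x)"
  proof (rule regular_on_frac[OF *(1)])
    show "poly_fun (\<lambda>y. p y * q' y)" "poly_fun (\<lambda>y. q y * p' y)"
      by (intro poly_fun.mult *(3-6))+
  qed (simp_all add: *(7-10) p')
qed

lemma openin_regular_nonzero:
  assumes "regular_on U f"
  shows "openin zariski {x \<in> U. f x \<noteq> 0}"
proof (subst openin_subopen, intro ballI)
  fix x assume x: "x \<in> {x \<in> U. f x \<noteq> 0}"
  then have "x \<in> U" by simp
  obtain V p q where V: "openin zariski V" "x \<in> V" "V \<subseteq> U" "poly_fun p" "poly_fun q"
      "\<And>y. y \<in> V \<Longrightarrow> q y \<noteq> 0" "\<And>y. y \<in> V \<Longrightarrow> f y = p y / q y"
    by (rule regular_onE[OF assms \<open>x \<in> U\<close>]) (rule that)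
  have "openin zariski (V \<inter> {y. p y \<noteq> 0})"
    by (rule openin_Int[OF V(1) openin_zariski_poly[OF V(4)]])
  moreover have "x \<in> V \<inter> {y. p y \<noteq> 0}" using V(2) V(7)[OF V(2)] x by auto
  moreover have "V \<inter> {y. p y \<noteq> 0} \<subseteq> {x \<in> U. f x \<noteq> 0}"
  proof
    fix y assume "y \<in> V \<inter> {y. p y \<noteq> 0}"
    then show "y \<in> {x \<in> U. f x \<noteq> 0}" using V(6)[of y] V(7)[of y] subsetD[OF V(3), of y] by simp
  qed
  ultimately show "\<exists>T. openin zariski T \<and> x \<in> T \<and> T \<subseteq> {x \<in> U. f x \<noteq> 0}" by blast
qed

lemma regular_on_poly_compose:
  assumes "openin zariski U" "morphism_on U f" "poly_fun p"
  shows "regular_on U (\<lambda>x. p (f x))"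
  using assms(3)
proof induction
  case (const c)
  then show ?case using assms(1) regular_on_poly poly_fun.const by blast
next
  case (coord i)
  then show ?case using assms(2) by (simp add: morphism_on_def)
qed (auto intro: regular_on_add regular_on_mult)

lemma openin_morphism_preimage:
  assumes "openin zariski U" "morphism_on U f" "openin zariski V"
  shows "openin zariski {x \<in> U. f x \<in> V}"
proof (subst openin_subopen, intro ballI)
  fix x assume x: "x \<in> {x \<in> U. f x \<in> V}"
  then obtain h where h: "poly_fun h" "h (f x) \<noteq> 0" "{y. h y \<noteq> 0} \<subseteq> V"
    using assms(3) unfolding openin_zariski_local by blast
  have "openin zariski {x \<in> U. h (f x) \<noteq> 0}"
    by (rule openin_regular_nonzero[OF regular_on_poly_compose[OF assms(1,2) h(1)]])
  then show "\<exists>T. openin zariski T \<and> x \<in> T \<and> T \<subseteq> {x \<in> U. f x \<in> V}"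
    using h x by (intro exI[of _ "{x \<in> U. h (f x) \<noteq> 0}"]) auto
qed

lemma morphism_on_subset:
  "morphism_on U f \<Longrightarrow> openin zariski V \<Longrightarrow> V \<subseteq> U \<Longrightarrow> morphism_on V f"
  unfolding morphism_on_def using regular_on_subset by blast

lemma morphism_on_compose:
  assumes "openin zariski U" "morphism_on U f" "openin zariski V" "morphism_on V g"
  shows "morphism_on {x \<in> U. f x \<in> V} (g \<circ> f)"
  unfolding morphism_on_def
proof (intro allI regular_onI)
  fix i x assume x: "x \<in> {x \<in> U. f x \<in> V}"
  have gi: "regular_on V (\<lambda>y. g y $ i)" using assms(4) by (simp add: morphism_on_def)
  have fx: "f x \<in> V" using x by simp
  obtain W p q where W: "openin zariski W" "f x \<in> W" "W \<subseteq> V" "poly_fun p" "poly_fun q"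
      "\<And>y. y \<in> W \<Longrightarrow> q y \<noteq> 0" "\<And>y. y \<in> W \<Longrightarrow> g y $ i = p y / q y"
    by (rule regular_onE[OF gi fx]) (rule that)
  define T where "T = {x \<in> U. f x \<in> W}"
  have T: "openin zariski T"
    unfolding T_def by (rule openin_morphism_preimage[OF assms(1,2) W(1)])
  have "morphism_on T f" using morphism_on_subset[OF assms(2) T] by (auto simp: T_def)
  then have "regular_on T (\<lambda>x. p (f x) / q (f x))"
    by (intro regular_on_divide regular_on_poly_compose[OF T] W(4,5)) (auto simp: T_def W(6))
  then have "regular_on T (\<lambda>x. (g \<circ> f) x $ i)"
    by (rule regular_on_cong) (simp add: T_def W(7))
  then show "\<exists>T. openin zariski T \<and> x \<in> T \<and> T \<subseteq> {x \<in> U. f x \<in> V} \<and>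
      regular_on T (\<lambda>x. (g \<circ> f) x $ i)"
    using T W x by (intro exI[of _ T]) (auto simp: T_def)
qed

lemma morphism_on_eqI:
  fixes f g :: "'a::alg_closed_field ^ 'n \<Rightarrow> 'a ^ 'n"
  assumes "morphism_on U f" "morphism_on U g"
    and "openin zariski W" "W \<noteq> {}" "\<And>x. x \<in> W \<Longrightarrow> x \<in> U \<Longrightarrow> f x = g x" and "x \<in> U"
  shows "f x = g x"
proof (rule ccontr)
  assume "f x \<noteq> g x"
  then obtain i where i: "f x $ i - g x $ i \<noteq> 0" by (auto simp: vec_eq_iff)
  have "openin zariski {x \<in> U. f x $ i - g x $ i \<noteq> 0}"
    using assms(1,2) unfolding morphism_on_def
    by (intro openin_regular_nonzero regular_on_diff) auto
  then have "{x \<in> U. f x $ i - g x $ i \<noteq> 0} \<inter> W \<noteq> {}"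
    using zariski_irreducible assms(3,4,6) i by blast
  then show False using assms(5) by auto
qed

lemma morphism_on_linear: "morphism_on UNIV (\<lambda>x. A *v x)"
  unfolding morphism_on_def matrix_vector_mult_def
  by (auto intro!: regular_on_poly poly_fun_sum poly_fun.intros)

lemma morphism_on_id: "morphism_on UNIV (\<lambda>x. x)"
  unfolding morphism_on_def by (auto intro!: regular_on_poly poly_fun.intros)


section \<open>Rational self-maps of affine space\<close>

definition ratmap_rep :: "('a::field ^ 'n) set \<times> ('a ^ 'n \<Rightarrow> 'a ^ 'n) \<Rightarrow> bool" where
  "ratmap_rep = (\<lambda>(U, f). openin zariski U \<and> U \<noteq> {} \<and> morphism_on U f)"

definition ratmap_rel ::
  "('a::field ^ 'n) set \<times> ('a ^ 'n \<Rightarrow> 'a ^ 'n) \<Rightarrow> ('a ^ 'n) set \<times> ('a ^ 'n \<Rightarrow> 'a ^ 'n) \<Rightarrow> bool" where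
  "ratmap_rel = (\<lambda>(U, f) (V, g). ratmap_rep (U, f) \<and> ratmap_rep (V, g) \<and> (\<forall>x\<in>U \<inter> V. f x = g x))"

lemma ratmap_relE:
  assumes "ratmap_rel a b"
  obtains U f V g where "a = (U, f)" "b = (V, g)" "openin zariski U" "U \<noteq> {}" "morphism_on U f"
    "openin zariski V" "V \<noteq> {}" "morphism_on V g" "\<And>x. x \<in> U \<Longrightarrow> x \<in> V \<Longrightarrow> f x = g x"
  using assms by (cases a; cases b) (auto simp: ratmap_rel_def ratmap_rep_def)

lemma ratmap_relI:
  assumes "openin zariski U" "U \<noteq> {}" "morphism_on U f"
    "openin zariski V" "V \<noteq> {}" "morphism_on V g" "\<And>x. x \<in> U \<Longrightarrow> x \<in> V \<Longrightarrow> f x = g x"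
  shows "ratmap_rel (U, f) (V, g)"
  using assms by (auto simp: ratmap_rel_def ratmap_rep_def)

lemma ratmap_rel_generic:
  fixes U V W :: "('a::alg_closed_field ^ 'n) set"
  assumes "openin zariski U" "U \<noteq> {}" "morphism_on U f"
    and "openin zariski V" "V \<noteq> {}" "morphism_on V g"
    and "openin zariski W" "W \<noteq> {}" "\<And>x. x \<in> U \<Longrightarrow> x \<in> V \<Longrightarrow> x \<in> W \<Longrightarrow> f x = g x"
  shows "ratmap_rel (U, f) (V, g)"
proof (rule ratmap_relI)
  fix x assume "x \<in> U" "x \<in> V"
  moreover have UV: "openin zariski (U \<inter> V)" using assms by blast
  moreover have "morphism_on (U \<inter> V) f" "morphism_on (U \<inter> V) g"
    using morphism_on_subset[OF _ UV] assms by blast+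
  ultimately show "f x = g x"
    using morphism_on_eqI[of "U \<inter> V" f g W x] assms by blast
qed (use assms in auto)

lemma part_equivp_ratmap_rel:
  "part_equivp (ratmap_rel ::
    ('a::alg_closed_field ^ 'n) set \<times> ('a ^ 'n \<Rightarrow> 'a ^ 'n) \<Rightarrow> ('a ^ 'n) set \<times> ('a ^ 'n \<Rightarrow> 'a ^ 'n) \<Rightarrow> bool)"
proof (rule part_equivpI)
  show "\<exists>r::('a ^ 'n) set \<times> ('a ^ 'n \<Rightarrow> 'a ^ 'n). ratmap_rel r r"
    by (intro exI[of _ "(UNIV, \<lambda>x. x)"] ratmap_relI) (auto simp: morphism_on_id)
  show "symp (ratmap_rel ::
    ('a ^ 'n) set \<times> ('a ^ 'n \<Rightarrow> 'a ^ 'n) \<Rightarrow> ('a ^ 'n) set \<times> ('a ^ 'n \<Rightarrow> 'a ^ 'n) \<Rightarrow> bool)"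
    by (auto simp: symp_def ratmap_rel_def)
  show "transp (ratmap_rel ::
    ('a ^ 'n) set \<times> ('a ^ 'n \<Rightarrow> 'a ^ 'n) \<Rightarrow> ('a ^ 'n) set \<times> ('a ^ 'n \<Rightarrow> 'a ^ 'n) \<Rightarrow> bool)"
  proof (rule transpI)
    fix a b c :: "('a ^ 'n) set \<times> ('a ^ 'n \<Rightarrow> 'a ^ 'n)"
    assume ab: "ratmap_rel a b" and bc: "ratmap_rel b c"
    obtain U f V g where a: "a = (U, f)" and b: "b = (V, g)" and U: "openin zariski U" "U \<noteq> {}"
      "morphism_on U f" and V: "openin zariski V" "V \<noteq> {}" "\<And>x. x \<in> U \<Longrightarrow> x \<in> V \<Longrightarrow> f x = g x"
      by (rule ratmap_relE[OF ab]) (rule that)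
    obtain W h where c: "c = (W, h)" and W: "openin zariski W" "W \<noteq> {}" "morphism_on W h"
       "\<And>x. x \<in> V \<Longrightarrow> x \<in> W \<Longrightarrow> g x = h x"
      using bc unfolding b by (auto elim!: ratmap_relE)
    show "ratmap_rel a c"
      unfolding a c by (rule ratmap_rel_generic[OF U W(1-3) V(1,2)]) (simp add: V(3) W(4))
  qed
qed

quotient_type (overloaded) ('a, 'n) ratmap =
  "('a::alg_closed_field ^ 'n::finite) set \<times> ('a ^ 'n \<Rightarrow> 'a ^ 'n)" / partial: ratmap_rel
  by (rule part_equivp_ratmap_rel)

text \<open>Dominance does not depend on the chosen domain of definition.\<close>

lift_definition dominant :: "('a::alg_closed_field, 'n::finite) ratmap \<Rightarrow> bool"
  is "\<lambda>(U, f). zariski closure_of (f ` U) = UNIV"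
proof -
  have *: "zariski closure_of (g ` V) = UNIV"
    if rel: "ratmap_rel (U, f) (V, g)" and dense: "zariski closure_of (f ` U) = UNIV" for U V f and g :: "'a ^ 'n \<Rightarrow> 'a ^ 'n"
    unfolding zariski_dense_iff
  proof (intro allI impI, elim conjE)
    fix W :: "('a ^ 'n) set" assume W: "openin zariski W" "W \<noteq> {}"
    have UV: "openin zariski U" "morphism_on U f" "openin zariski V" "V \<noteq> {}"
      "\<And>x. x \<in> U \<Longrightarrow> x \<in> V \<Longrightarrow> f x = g x"
      using rel by (auto elim!: ratmap_relE)
    obtain x where "x \<in> U" "f x \<in> W" by (rule zariski_denseD[OF dense W])
    then have "{x \<in> U. f x \<in> W} \<noteq> {}" by auto
    then have "{x \<in> U. f x \<in> W} \<inter> V \<noteq> {}"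
      by (intro zariski_irreducible openin_morphism_preimage UV W)
    then show "g ` V \<inter> W \<noteq> {}" using UV(5) by fastforce
  qed
  fix a b :: "('a ^ 'n) set \<times> ('a ^ 'n \<Rightarrow> 'a ^ 'n)"
  assume "ratmap_rel a b"
  moreover have "ratmap_rel b a"
    using \<open>ratmap_rel a b\<close> by (auto simp: ratmap_rel_def)
  ultimately show "(case a of (U, f) \<Rightarrow> zariski closure_of (f ` U) = UNIV) =
      (case b of (U, f) \<Rightarrow> zariski closure_of (f ` U) = UNIV)"
    using * by (cases a; cases b) auto
qed

text \<open>
  \<open>\<psi> \<circ>\<^sub>r \<phi>\<close> is composition of rational maps, which is defined for dominant \<open>\<phi>\<close> only;
  for other \<open>\<phi>\<close> the value is arbitrary and never used below.
\<close>

lift_definition ratmap_comp ::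
  "('a::alg_closed_field, 'n::finite) ratmap \<Rightarrow> ('a, 'n) ratmap \<Rightarrow> ('a, 'n) ratmap" (infixl "\<circ>\<^sub>r" 70)
  is "\<lambda>(V, g) (U, f). if zariski closure_of (f ` U) = UNIV then ({x \<in> U. f x \<in> V}, g \<circ> f)
        else (UNIV, \<lambda>x. x)"
proof -
  fix b b' a a' :: "('a ^ 'n) set \<times> ('a ^ 'n \<Rightarrow> 'a ^ 'n)"
  assume bb: "ratmap_rel b b'" and aa: "ratmap_rel a a'"
  obtain V g V' g' where b: "b = (V, g)" "b' = (V', g')"
    and V: "openin zariski V" "V \<noteq> {}" "morphism_on V g"
    and V': "openin zariski V'" "V' \<noteq> {}" "morphism_on V' g'"
    and VV: "\<And>x. x \<in> V \<Longrightarrow> x \<in> V' \<Longrightarrow> g x = g' x"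
    by (rule ratmap_relE[OF bb]) (rule that)
  obtain U f U' f' where a: "a = (U, f)" "a' = (U', f')"
    and U: "openin zariski U" "U \<noteq> {}" "morphism_on U f"
    and U': "openin zariski U'" "U' \<noteq> {}" "morphism_on U' f'"
    and UU: "\<And>x. x \<in> U \<Longrightarrow> x \<in> U' \<Longrightarrow> f x = f' x"
    by (rule ratmap_relE[OF aa]) (rule that)
  have dom: "zariski closure_of (f ` U) = UNIV \<longleftrightarrow> zariski closure_of (f' ` U') = UNIV"
    using rel_funD[OF dominant.rsp aa] by (simp add: a)
  have nonempty: "{x \<in> U. f x \<in> V} \<noteq> {}" if "zariski closure_of (f ` U) = UNIV"
    "openin zariski V" "V \<noteq> {}" for U V and f :: "'a ^ 'n \<Rightarrow> 'a ^ 'n"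
    using zariski_denseD[OF that] by blast
  show "ratmap_rel
     ((case b of (V, g) \<Rightarrow> \<lambda>(U, f). if zariski closure_of (f ` U) = UNIV
        then ({x \<in> U. f x \<in> V}, g \<circ> f) else (UNIV, \<lambda>x. x)) a)
     ((case b' of (V, g) \<Rightarrow> \<lambda>(U, f). if zariski closure_of (f ` U) = UNIV
        then ({x \<in> U. f x \<in> V}, g \<circ> f) else (UNIV, \<lambda>x. x)) a')"
  proof (cases "zariski closure_of (f ` U) = UNIV")
    case True
    have "ratmap_rel ({x \<in> U. f x \<in> V}, g \<circ> f) ({x \<in> U'. f' x \<in> V'}, g' \<circ> f')"
    proof (rule ratmap_relI)
      show "{x \<in> U. f x \<in> V} \<noteq> {}" using nonempty True V by blast
      show "{x \<in> U'. f' x \<in> V'} \<noteq> {}" using nonempty True dom V' by blast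
    qed (use U U' V V' UU VV in \<open>auto intro!: openin_morphism_preimage morphism_on_compose\<close>)
    then show ?thesis using True dom by (simp add: a b)
  next
    case False
    then show ?thesis using dom by (simp add: a b ratmap_relI morphism_on_id)
  qed
qed

lift_definition ratmap_id :: "('a::alg_closed_field, 'n::finite) ratmap"
  is "(UNIV, \<lambda>x. x)"
  by (simp add: ratmap_relI morphism_on_id)

lift_definition linear_ratmap :: "'a ^ 'n ^ 'n \<Rightarrow> ('a::alg_closed_field, 'n::finite) ratmap"
  is "\<lambda>A. (UNIV, \<lambda>x. A *v x)"
  by (simp add: ratmap_relI morphism_on_linear)

definition birational :: "('a::alg_closed_field, 'n::finite) ratmap \<Rightarrow> bool" where
  "birational \<phi> \<longleftrightarrow>
    dominant \<phi> \<and> (\<exists>\<psi>. dominant \<psi> \<and> \<psi> \<circ>\<^sub>r \<phi> = ratmap_id \<and> \<phi> \<circ>\<^sub>r \<psi> = ratmap_id)"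


section \<open>The Cremona group and self-compressibility\<close>

definition Cr :: "('a::alg_closed_field, 'n::finite) ratmap monoid" where
  "Cr = \<lparr>carrier = Collect birational, mult = (\<circ>\<^sub>r), one = ratmap_id\<rparr>"

definition GL :: "('a::alg_closed_field, 'n::finite) ratmap set" where
  "GL = linear_ratmap ` {A. invertible A}"

definition nontrivially_self_compressible :: "('a::alg_closed_field, 'n::finite) ratmap set \<Rightarrow> bool" where
  "nontrivially_self_compressible G \<longleftrightarrow>
    (\<exists>\<phi>. dominant \<phi> \<and> \<not> birational \<phi> \<and> (\<forall>g\<in>G. \<phi> \<circ>\<^sub>r g = g \<circ>\<^sub>r \<phi>))"

lemma dominant_id: "dominant ratmap_id"
  by transfer simp

lemma dominant_comp:
  fixes \<phi> \<psi> :: "('a::alg_closed_field, 'n::finite) ratmap"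
  assumes "dominant \<phi>" "dominant \<psi>"
  shows "dominant (\<psi> \<circ>\<^sub>r \<phi>)"
  using assms
proof transfer
  fix a b :: "('a ^ 'n) set \<times> ('a ^ 'n \<Rightarrow> 'a ^ 'n)"
  assume aa: "ratmap_rel a a" and bb: "ratmap_rel b b"
    and da: "case a of (U, f) \<Rightarrow> zariski closure_of (f ` U) = UNIV"
    and db: "case b of (U, f) \<Rightarrow> zariski closure_of (f ` U) = UNIV"
  obtain U f where a: "a = (U, f)" "openin zariski U" "morphism_on U f"
    using aa by (auto elim: ratmap_relE)
  obtain V g where b: "b = (V, g)" "openin zariski V" "morphism_on V g"
    using bb by (auto elim: ratmap_relE)
  have "zariski closure_of ((g \<circ> f) ` {x \<in> U. f x \<in> V}) = UNIV"
    unfolding zariski_dense_iff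
  proof (intro allI impI, elim conjE)
    fix W :: "('a ^ 'n) set" assume W: "openin zariski W" "W \<noteq> {}"
    have "openin zariski {y \<in> V. g y \<in> W}" using openin_morphism_preimage b W by blast
    moreover obtain y where "y \<in> V" "g y \<in> W"
      by (rule zariski_denseD[of g V W]) (use db W in \<open>auto simp: b\<close>)
    then have "{y \<in> V. g y \<in> W} \<noteq> {}" by auto
    ultimately obtain x where "x \<in> U" "f x \<in> {y \<in> V. g y \<in> W}"
      by (rule zariski_denseD[OF da[unfolded a prod.case]])
    then have "(g \<circ> f) x \<in> (g \<circ> f) ` {x \<in> U. f x \<in> V} \<inter> W" by auto
    then show "(g \<circ> f) ` {x \<in> U. f x \<in> V} \<inter> W \<noteq> {}" by blast
  qed
  then show "case (case b of (V, g) \<Rightarrow> \<lambda>(U, f). if zariski closure_of (f ` U) = UNIV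
      then ({x \<in> U. f x \<in> V}, g \<circ> f) else (UNIV, \<lambda>x. x)) a of (U, f) \<Rightarrow>
      zariski closure_of (f ` U) = UNIV"
    using da by (simp add: a b)
qed

lemma ratmap_comp_assoc:
  fixes \<phi> \<psi> \<eta> :: "('a::alg_closed_field, 'n::finite) ratmap"
  assumes "dominant \<phi>" "dominant \<psi>"
  shows "(\<eta> \<circ>\<^sub>r \<psi>) \<circ>\<^sub>r \<phi> = \<eta> \<circ>\<^sub>r (\<psi> \<circ>\<^sub>r \<phi>)"
  using assms dominant_comp[OF assms]
proof transfer
  fix a b c :: "('a ^ 'n) set \<times> ('a ^ 'n \<Rightarrow> 'a ^ 'n)"
  let ?D = "\<lambda>(U, f::'a ^ 'n \<Rightarrow> 'a ^ 'n). zariski closure_of (f ` U) = UNIV"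
  let ?C = "\<lambda>(V, g) (U, f). if zariski closure_of (f ` U) = (UNIV::('a ^ 'n) set)
    then ({x::'a ^ 'n \<in> U. f x \<in> V}, g \<circ> f) else (UNIV, \<lambda>x. x)"
  assume aa: "ratmap_rel a a" and bb: "ratmap_rel b b" and cc: "ratmap_rel c c"
    and da: "?D a" and db: "?D b" and dba: "?D (?C b a)"
  obtain U f where a: "a = (U, f)" by (cases a)
  obtain V g where b: "b = (V, g)" by (cases b)
  obtain W h where c: "c = (W, h)" by (cases c)
  have "?C (?C c b) a = ?C c (?C b a)"
    using da db dba by (auto simp: a b c)
  moreover have "ratmap_rel (?C c (?C b a)) (?C c (?C b a))"
    using ratmap_comp.rsp aa bb cc unfolding rel_fun_def by blast
  ultimately show "ratmap_rel (?C (?C c b) a) (?C c (?C b a))" by metis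
qed

lemma ratmap_comp_id_right: "\<phi> \<circ>\<^sub>r ratmap_id = \<phi>"
  by transfer (auto simp: comp_def split: prod.splits)

lemma ratmap_comp_id_left:
  assumes "dominant \<phi>"
  shows "ratmap_id \<circ>\<^sub>r \<phi> = \<phi>"
  using assms by transfer (auto simp: comp_def split: prod.splits)

lemma group_Cr: "group Cr"
proof (rule groupI)
  fix \<phi> \<psi> :: "('a, 'b) ratmap"
  assume "\<phi> \<in> carrier Cr" "\<psi> \<in> carrier Cr"
  then obtain \<phi>' \<psi>' where d: "dominant \<phi>" "dominant \<psi>" "dominant \<phi>'" "dominant \<psi>'"
    and i: "\<phi>' \<circ>\<^sub>r \<phi> = ratmap_id" "\<phi> \<circ>\<^sub>r \<phi>' = ratmap_id"
      "\<psi>' \<circ>\<^sub>r \<psi> = ratmap_id" "\<psi> \<circ>\<^sub>r \<psi>' = ratmap_id"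
    by (auto simp: Cr_def birational_def)
  have "(\<psi>' \<circ>\<^sub>r \<phi>') \<circ>\<^sub>r (\<phi> \<circ>\<^sub>r \<psi>) = ratmap_id" "(\<phi> \<circ>\<^sub>r \<psi>) \<circ>\<^sub>r (\<psi>' \<circ>\<^sub>r \<phi>') = ratmap_id"
    using d i by (metis ratmap_comp_assoc dominant_comp ratmap_comp_id_left)+
  then show "\<phi> \<otimes>\<^bsub>Cr\<^esub> \<psi> \<in> carrier Cr"
    using d dominant_comp by (auto simp: Cr_def birational_def)
next
  fix \<phi> :: "('a, 'b) ratmap"
  assume "\<phi> \<in> carrier Cr"
  then show "\<exists>\<psi>\<in>carrier Cr. \<psi> \<otimes>\<^bsub>Cr\<^esub> \<phi> = \<one>\<^bsub>Cr\<^esub>"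
    by (auto simp: Cr_def birational_def)
qed (auto simp: Cr_def birational_def dominant_id ratmap_comp_id_right ratmap_comp_id_left
      ratmap_comp_assoc)

lemma dominant_linear:
  assumes "invertible A"
  shows "dominant (linear_ratmap A)"
proof -
  have "range (\<lambda>x. A *v x) = UNIV"
    using assms matrix_right_invertible_surjective[of A] unfolding invertible_def by blast
  then show ?thesis by transfer simp
qed

lemma linear_ratmap_comp:
  assumes "invertible B"
  shows "linear_ratmap A \<circ>\<^sub>r linear_ratmap B = linear_ratmap (A ** B)"
proof -
  have "range (\<lambda>x. B *v x) = UNIV"
    using assms matrix_right_invertible_surjective[of B] unfolding invertible_def by blast
  then show ?thesis
    by transfer (simp add: comp_def matrix_vector_mul_assoc ratmap_relI morphism_on_linear)
qed

lemma linear_ratmap_one: "linear_ratmap (mat 1) = ratmap_id"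
  by transfer (simp add: ratmap_relI morphism_on_id)

lemma subgroup_GL: "subgroup (GL :: ('a::alg_closed_field, 'n::finite) ratmap set) Cr"
proof -
  interpret Cr: group "Cr :: ('a, 'n) ratmap monoid" by (rule group_Cr)
  have inv: "\<exists>B. invertible B \<and> A ** B = mat 1 \<and> B ** A = mat 1" if "invertible A"
    for A :: "'a ^ 'n ^ 'n"
    using that unfolding invertible_def by blast
  have carr: "linear_ratmap A \<in> carrier Cr" if A: "invertible A" for A :: "'a ^ 'n ^ 'n"
  proof -
    obtain B where "invertible B" "A ** B = mat 1" "B ** A = mat 1" using inv[OF A] by blast
    then have "dominant (linear_ratmap B)" "linear_ratmap B \<circ>\<^sub>r linear_ratmap A = ratmap_id"
      "linear_ratmap A \<circ>\<^sub>r linear_ratmap B = ratmap_id"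
      using A by (simp_all add: dominant_linear linear_ratmap_comp linear_ratmap_one)
    then show ?thesis using dominant_linear[OF A] by (auto simp: Cr_def birational_def)
  qed
  show ?thesis
  proof (rule Cr.subgroupI)
    show "GL \<subseteq> carrier (Cr :: ('a, 'n) ratmap monoid)" using carr by (auto simp: GL_def)
    have "invertible (mat 1 :: 'a ^ 'n ^ 'n)" unfolding invertible_def by auto
    then show "(GL :: ('a, 'n) ratmap set) \<noteq> {}" by (auto simp: GL_def)
  next
    fix \<phi> :: "('a, 'n) ratmap" assume "\<phi> \<in> GL"
    then obtain A where A: "\<phi> = linear_ratmap A" "invertible A" by (auto simp: GL_def)
    obtain B where B: "invertible B" "B ** A = mat 1" using inv[OF A(2)] by blast
    have "linear_ratmap B \<otimes>\<^bsub>Cr\<^esub> linear_ratmap A = \<one>\<^bsub>Cr\<^esub>"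
      using A B by (simp add: Cr_def linear_ratmap_comp linear_ratmap_one)
    then have "inv\<^bsub>Cr\<^esub> \<phi> = linear_ratmap B"
      using carr A B Cr.inv_equality by blast
    then show "inv\<^bsub>Cr\<^esub> \<phi> \<in> GL" using B by (auto simp: GL_def)
  next
    fix \<phi> \<psi> :: "('a, 'n) ratmap" assume "\<phi> \<in> GL" "\<psi> \<in> GL"
    then show "\<phi> \<otimes>\<^bsub>Cr\<^esub> \<psi> \<in> GL"
      by (auto simp: GL_def Cr_def linear_ratmap_comp invertible_mult)
  qed
qed

end

theory Submission
  imports Defs
begin

text \<open>
  Let \<open>H\<close> be a finite linear group and \<open>f\<close> the product of the \<open>H\<close>-translates of a coordinate
  function, an \<open>H\<close>-invariant form of degree \<open>d = |H| > 0\<close>.  The map \<open>\<phi> x = f x \<cdot> x\<close> commutes with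
  \<open>H\<close>.  It satisfies \<open>\<phi> (t x) = t ^ (d + 1) \<cdot> \<phi> x\<close>: extracting a root of order \<open>d + 1\<close> shows that its
  image contains every point where \<open>f\<close> does not vanish, so it is dominant, and \<open>\<phi> (\<zeta> x) = \<phi> x\<close> for a
  nontrivial root of unity \<open>\<zeta>\<close> of order dividing \<open>d + 1\<close>, so it is not birational.  Conjugating
  \<open>\<phi>\<close> handles the groups that are only conjugate to a linear one.
\<close>

lemma poly_fun_prod: "(\<And>i. i \<in> A \<Longrightarrow> poly_fun (p i)) \<Longrightarrow> poly_fun (\<lambda>x. \<Prod>i\<in>A. p i x)"
  by (induction A rule: infinite_finite_induct) (auto intro: poly_fun.const poly_fun.mult)

text \<open>Affine space is irreducible, so the nonvanishing loci of finitely many nonzero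
  polynomials have a common point. This makes the invariant form below nonzero.\<close>

lemma ex_prod_poly_fun_nonzero:
  fixes p :: "'i \<Rightarrow> 'a::alg_closed_field ^ 'n \<Rightarrow> 'a"
  assumes "finite A" "\<And>i. i \<in> A \<Longrightarrow> poly_fun (p i)" "\<And>i. i \<in> A \<Longrightarrow> \<exists>x. p i x \<noteq> 0"
  shows "\<exists>x. (\<Prod>i\<in>A. p i x) \<noteq> 0"
  using assms
proof (induction A rule: finite_induct)
  case (insert i A)
  have "{x. p i x \<noteq> 0} \<inter> {x. (\<Prod>i\<in>A. p i x) \<noteq> 0} \<noteq> {}"
    by (intro zariski_irreducible openin_zariski_poly poly_fun_prod)
      (use insert in \<open>auto simp del: prod_zero_iff\<close>)
  then show ?case using insert.hyps by auto
qed simp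

text \<open>Any root of \<open>1 + t + ... + t ^ (n - 1)\<close> will do: in characteristic zero the
  value of this polynomial at 1 is \<open>n\<close>, which is nonzero.\<close>

lemma ex_nontrivial_root_of_unity:
  assumes "n \<ge> 2"
  shows "\<exists>z::'a::{alg_closed_field, field_char_0}. z \<noteq> 1 \<and> z ^ n = 1"
proof -
  define P :: "'a poly" where "P = (\<Sum>i<n. monom 1 i)"
  have P: "poly P t = (\<Sum>i<n. t ^ i)" for t
    by (simp add: P_def poly_sum poly_monom)
  have "coeff P (n - 1) \<noteq> 0"
    using assms by (simp add: P_def coeff_sum)
  then have "degree P > 0" using le_degree[of P "n - 1"] assms by linarith
  then obtain z where z: "poly P z = 0" using alg_closed_imp_poly_has_root by blast
  have "z \<noteq> 1" using z assms by (auto simp: P)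
  moreover have "z ^ n - 1 = 0"
    using z by (simp add: power_diff_1_eq P)
  ultimately show ?thesis by auto
qed

text \<open>The conditional makes the lift total: a non-polynomial \<open>f\<close> is replaced by \<open>1\<close>.\<close>

lift_definition scaling_ratmap ::
  "('a ^ 'n \<Rightarrow> 'a) \<Rightarrow> ('a::alg_closed_field, 'n::finite) ratmap"
  is "\<lambda>f. (UNIV, \<lambda>x. (if poly_fun f then f x else 1) *s x)"
proof -
  fix f :: "'a ^ 'n \<Rightarrow> 'a"
  have "poly_fun (\<lambda>x. if poly_fun f then f x else 1)"
    by (cases "poly_fun f") (auto intro: poly_fun.const)
  then show "ratmap_rel (UNIV, \<lambda>x. (if poly_fun f then f x else 1) *s x)
      (UNIV, \<lambda>x. (if poly_fun f then f x else 1) *s x)"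
    by (auto intro!: ratmap_relI regular_on_poly poly_fun.mult poly_fun.coord simp: morphism_on_def)
qed

lemma dense_range_scaling:
  fixes f :: "'a::alg_closed_field ^ 'n::finite \<Rightarrow> 'a"
  assumes "poly_fun f" "\<And>t x. f (t *s x) = t ^ d * f x" "f v \<noteq> 0"
  shows "zariski closure_of range (\<lambda>x. f x *s x) = UNIV"
  unfolding zariski_dense_iff
proof (intro allI impI, elim conjE)
  fix W :: "('a ^ 'n) set" assume W: "openin zariski W" "W \<noteq> {}"
  have "W \<inter> {x. f x \<noteq> 0} \<noteq> {}"
    by (rule zariski_irreducible[OF W]) (use assms in \<open>auto intro!: openin_zariski_poly\<close>)
  then obtain y where y: "y \<in> W" "f y \<noteq> 0" by blast
  \<comment> \<open>Homogeneity gives one factor \<open>t ^ d\<close> and the vector itself one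
    more, so this \<open>t\<close> makes \<open>t *s y\<close> a preimage of
    \<open>y\<close>.\<close>
  obtain t where t: "t ^ Suc d = inverse (f y)" using nth_root_exists[of "Suc d"] by blast
  have "f (t *s y) *s (t *s y) = (t ^ Suc d * f y) *s y"
    by (simp add: assms(2) vector_smult_assoc mult_ac)
  also have "\<dots> = y" using t y by simp
  finally have "y \<in> range (\<lambda>x. f x *s x)" by (rule range_eqI[OF sym])
  then show "range (\<lambda>x. f x *s x) \<inter> W \<noteq> {}" using y(1) by blast
qed

lemma dominant_scaling_ratmap:
  fixes f :: "'a::alg_closed_field ^ 'n::finite \<Rightarrow> 'a"
  assumes "poly_fun f" "\<And>t x. f (t *s x) = t ^ d * f x" "f v \<noteq> 0"
  shows "dominant (scaling_ratmap f)"
  using assms(1) dense_range_scaling[OF assms] by transfer simp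

text \<open>A left inverse would separate generic points, but \<open>x\<close> and its multiple by a
  nontrivial root of unity of order dividing \<open>d + 1\<close> have the same image.\<close>

lemma scaling_ratmap_no_left_inverse:
  fixes f :: "'a::{alg_closed_field, field_char_0} ^ 'n::finite \<Rightarrow> 'a"
  assumes f: "poly_fun f" "\<And>t x. f (t *s x) = t ^ d * f x" "f v \<noteq> 0" and d: "d > 0"
  shows "\<psi> \<circ>\<^sub>r scaling_ratmap f \<noteq> ratmap_id"
proof (transfer fixing: f)
  fix b :: "('a ^ 'n) set \<times> ('a ^ 'n \<Rightarrow> 'a ^ 'n)"
  assume bb: "ratmap_rel b b"
  obtain V g where b: "b = (V, g)" "openin zariski V" "V \<noteq> {}"
    by (rule ratmap_relE[OF bb]) (rule that)
  let ?\<phi> = "\<lambda>x. f x *s x"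
  let ?S = "{x. ?\<phi> x \<in> V}"
  have dense: "zariski closure_of range ?\<phi> = UNIV" by (rule dense_range_scaling[OF f])
  have False if "ratmap_rel (?S, g \<circ> ?\<phi>) (UNIV, \<lambda>x. x)"
  proof -
    from that have S: "openin zariski ?S" and id: "\<And>x. x \<in> ?S \<Longrightarrow> g (?\<phi> x) = x"
      by (auto simp: ratmap_rel_def ratmap_rep_def)
    have "?S \<noteq> {}" using zariski_denseD[OF dense b(2,3)] by blast
    \<comment> \<open>Nonvanishing of \<open>f\<close> forces \<open>x\<close> to be nonzero, so
      that \<open>z *s x\<close> really differs from \<open>x\<close>.\<close>
    then have "?S \<inter> {x. f x \<noteq> 0} \<noteq> {}"
      by (intro zariski_irreducible S) (use f in \<open>auto intro: openin_zariski_poly\<close>)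
    then obtain x where x: "x \<in> ?S" "f x \<noteq> 0" by blast
    obtain z :: 'a where z: "z \<noteq> 1" "z ^ Suc d = 1"
      using ex_nontrivial_root_of_unity[of "Suc d"] d by auto
    have "?\<phi> (z *s x) = (z ^ Suc d) *s ?\<phi> x"
      by (simp add: f(2) vector_smult_assoc mult_ac)
    then have eq: "?\<phi> (z *s x) = ?\<phi> x" by (simp only: z vector_smult_lid)
    \<comment> \<open>Membership in \<open>?S\<close> depends on \<open>?\<phi> x\<close> alone, so
      the left inverse may be applied at \<open>z *s x\<close> as well.\<close>
    then have "z *s x \<in> ?S" using x(1) by (simp only: mem_Collect_eq)
    then have "z *s x = g (?\<phi> (z *s x))" by (rule id[symmetric])
    also have "\<dots> = x" by (simp only: eq id[OF x(1)])
    finally have "z *s x = x" .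
    then have "(z - 1) *s x = 0" by (simp add: vector_sub_rdistrib)
    then have "x = 0" using z(1) by (metis vector_mul_eq_0 right_minus_eq)
    then have "f x = 0" using f(2)[of 0 x] d by (auto simp: power_0_left)
    then show False using x by simp
  qed
  then show "\<not> ratmap_rel
     ((case b of (V, g) \<Rightarrow> \<lambda>(U, f). if zariski closure_of (f ` U) = UNIV
        then ({x \<in> U. f x \<in> V}, g \<circ> f) else (UNIV, \<lambda>x. x))
       (UNIV, \<lambda>x. (if poly_fun f then f x else 1) *s x))
     (UNIV, \<lambda>x. x)"
    using f(1) dense by (auto simp: b)
qed

text \<open>Both composites are \<open>x \<mapsto> f x *s (A *v x)\<close> on the whole space.
  Density of both ranges is what keeps \<open>\<circ>\<^sub>r\<close> from taking its default
  value.\<close>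

lemma scaling_ratmap_linear_commute:
  fixes f :: "'a::alg_closed_field ^ 'n::finite \<Rightarrow> 'a"
  assumes f: "poly_fun f" "\<And>t x. f (t *s x) = t ^ d * f x" "f v \<noteq> 0"
    and A: "invertible A" "\<And>x. f (A *v x) = f x"
  shows "scaling_ratmap f \<circ>\<^sub>r linear_ratmap A = linear_ratmap A \<circ>\<^sub>r scaling_ratmap f"
proof (transfer fixing: f A)
  have dense: "zariski closure_of range (\<lambda>x. f x *s x) = UNIV"
    by (rule dense_range_scaling[OF f])
  have range: "range (\<lambda>x. A *v x) = UNIV"
    using A(1) matrix_right_invertible_surjective[of A] unfolding invertible_def by blast
  have "morphism_on UNIV (\<lambda>x. f x *s (A *v x))"
    using f(1) unfolding morphism_on_def matrix_vector_mult_def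
    by (auto intro!: regular_on_poly poly_fun_sum poly_fun.intros)
  then show "ratmap_rel
     ((case (UNIV, \<lambda>x. (if poly_fun f then f x else 1) *s x) of
       (V, g) \<Rightarrow> \<lambda>(U, f). if zariski closure_of (f ` U) = UNIV
        then ({x \<in> U. f x \<in> V}, g \<circ> f) else (UNIV, \<lambda>x. x))
       (UNIV, \<lambda>x. A *v x))
     ((case (UNIV, \<lambda>x. A *v x) of (V, g) \<Rightarrow> \<lambda>(U, f). if zariski closure_of (f ` U) = UNIV
        then ({x \<in> U. f x \<in> V}, g \<circ> f) else (UNIV, \<lambda>x. x))
       (UNIV, \<lambda>x. (if poly_fun f then f x else 1) *s x))"
    using f(1) dense range A(2) by (simp add: comp_def vector_scalar_commute ratmap_relI)
qed

lemma inj_linear_ratmap: "inj linear_ratmap"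
proof (rule injI)
  fix A B :: "'a::alg_closed_field ^ 'n::finite ^ 'n"
  assume "linear_ratmap A = linear_ratmap B"
  then have "A *v x = B *v x" for x
    by (transfer fixing: x) (auto simp: ratmap_rel_def)
  then show "A = B" by (simp add: matrix_eq)
qed

lemma nontrivially_self_compressible_finite_linear:
  fixes H :: "('a::{alg_closed_field, field_char_0}, 'n::finite) ratmap set"
  assumes H: "subgroup H Cr" "H \<subseteq> GL" "finite H"
  shows "nontrivially_self_compressible H"
proof -
  \<comment> \<open>The matrix group behind \<open>H\<close>. It is finite because a linear map
    determines its matrix.\<close>
  define M where "M = {A. invertible A \<and> linear_ratmap A \<in> H}"
  have finM: "finite M"
    by (rule finite_subset[OF _ finite_vimageI[OF H(3) inj_linear_ratmap]]) (auto simp: M_def)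
  have "mat 1 \<in> M"
    using subgroup.one_closed[OF H(1)]
    by (auto simp: M_def Cr_def linear_ratmap_one invertible_def)
  then have d: "card M > 0" using finM by (auto simp: card_gt_0_iff)
  have mult: "A ** B \<in> M" if "A \<in> M" "B \<in> M" for A B
    using that subgroup.m_closed[OF H(1), of "linear_ratmap A" "linear_ratmap B"]
    by (auto simp: M_def Cr_def linear_ratmap_comp invertible_mult)
  have bij: "bij_betw (\<lambda>A. A ** B) M M" if B: "B \<in> M" for B
  proof -
    \<comment> \<open>Multiplying by \<open>C\<close> undoes right multiplication by
      \<open>B\<close>, which is therefore an injective self-map of the finite set \<open>M\<close>,
      hence a permutation.\<close>
    obtain C where "B ** C = mat 1" using B by (auto simp: M_def invertible_def)
    then have "A ** B ** C = A" for A by (simp flip: matrix_mul_assoc)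
    then have inj: "inj_on (\<lambda>A. A ** B) M" by (intro inj_on_inverseI)
    have "(\<lambda>A. A ** B) ` M \<subseteq> M" using mult[OF _ B] by (rule image_subsetI)
    from endo_inj_surj[OF finM this inj] inj show ?thesis by (simp only: bij_betw_def simp_thms)
  qed
  fix i :: 'n
  define f where "f = (\<lambda>x. \<Prod>A\<in>M. (A *v x) $ i)"
  have poly: "poly_fun (\<lambda>x. (A *v x) $ i)" for A :: "'a ^ 'n ^ 'n"
    unfolding matrix_vector_mult_def by (auto intro!: poly_fun_sum poly_fun.intros)
  have nonzero: "\<exists>x. (A *v x) $ i \<noteq> 0" if "A \<in> M" for A
  proof -
    obtain B where "A ** B = mat 1" using \<open>A \<in> M\<close> by (auto simp: M_def invertible_def)
    \<comment> \<open>The \<open>i\<close>-th coordinate of this vector is 1, so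
      \<open>B *v axis i 1\<close> is a witness.\<close>
    then have "A *v (B *v axis i 1) = axis i 1" by (simp add: matrix_vector_mul_assoc)
    then show ?thesis by (intro exI[of _ "B *v axis i 1"]) simp
  qed
  have f1: "poly_fun f" unfolding f_def by (intro poly_fun_prod poly)
  have f2: "f (t *s x) = t ^ card M * f x" for t x
    by (simp add: f_def vector_scalar_commute prod.distrib)
  obtain v where f3: "f v \<noteq> 0"
    using ex_prod_poly_fun_nonzero[OF finM, of "\<lambda>A x. (A *v x) $ i"] poly nonzero
    by (auto simp: f_def)
  have inv: "f (B *v x) = f x" if "B \<in> M" for B x
    unfolding f_def using prod.reindex_bij_betw[OF bij[OF that], of "\<lambda>A. (A *v x) $ i"]
    by (simp add: matrix_vector_mul_assoc)
  have "scaling_ratmap f \<circ>\<^sub>r h = h \<circ>\<^sub>r scaling_ratmap f" if "h \<in> H" for h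
  proof -
    obtain B where "h = linear_ratmap B" "B \<in> M" using H(2) \<open>h \<in> H\<close> by (auto simp: GL_def M_def)
    then show ?thesis
      using scaling_ratmap_linear_commute[OF f1 f2 f3, of B] inv by (auto simp: M_def)
  qed
  moreover have "\<not> birational (scaling_ratmap f)"
    using scaling_ratmap_no_left_inverse[OF f1 f2 f3 d] by (auto simp: birational_def)
  ultimately show ?thesis
    using dominant_scaling_ratmap[OF f1 f2 f3] by (auto simp: nontrivially_self_compressible_def)
qed

text \<open>If \<phi> serves for \<open>H\<close>, its conjugate
  \<open>c \<circ>\<^sub>r \<phi> \<circ>\<^sub>r c'\<close> serves for the conjugate group.\<close>

lemma nontrivially_self_compressible_conj:
  fixes H :: "('a::alg_closed_field, 'n::finite) ratmap set"
  assumes H: "nontrivially_self_compressible H" "H \<subseteq> carrier Cr" and c: "c \<in> carrier Cr"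
  shows "nontrivially_self_compressible ((\<lambda>h. c \<otimes>\<^bsub>Cr\<^esub> h \<otimes>\<^bsub>Cr\<^esub> inv\<^bsub>Cr\<^esub> c) ` H)"
proof -
  interpret Cr: group "Cr :: ('a, 'n) ratmap monoid" by (rule group_Cr)
  define c' where "c' = inv\<^bsub>Cr\<^esub> c"
  have c': "c' \<in> carrier Cr" using c by (simp add: c'_def)
  have bir: "birational c" "birational c'" using c c' by (auto simp: Cr_def)
  then have dom: "dominant c" "dominant c'" by (auto simp: birational_def)
  have cc: "c \<circ>\<^sub>r c' = ratmap_id" "c' \<circ>\<^sub>r c = ratmap_id"
    using Cr.r_inv[OF c] Cr.l_inv[OF c] by (simp_all add: c'_def Cr_def)
  \<comment> \<open>Since \<phi> lies outside \<open>Cr\<close>, the group laws do not reach it;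
    cancellation is derived for all dominant maps instead.\<close>
  have cancel: "c' \<circ>\<^sub>r (c \<circ>\<^sub>r \<eta>) = \<eta>" if "dominant \<eta>" for \<eta>
    using that dom cc by (simp add: ratmap_comp_id_left flip: ratmap_comp_assoc)
  obtain \<phi> where \<phi>: "dominant \<phi>" "\<not> birational \<phi>" "\<And>h. h \<in> H \<Longrightarrow> \<phi> \<circ>\<^sub>r h = h \<circ>\<^sub>r \<phi>"
    using H(1) by (auto simp: nontrivially_self_compressible_def)
  define \<theta> where "\<theta> = c \<circ>\<^sub>r \<phi> \<circ>\<^sub>r c'"
  have "dominant \<theta>" using \<phi> dom by (simp add: \<theta>_def dominant_comp)
  moreover have "\<not> birational \<theta>"
  proof
    assume "birational \<theta>"
    \<comment> \<open>Conjugating \<theta> back recovers \<phi>, which would then be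
      birational.\<close>
    then have "c' \<otimes>\<^bsub>Cr\<^esub> (\<theta> \<otimes>\<^bsub>Cr\<^esub> c) \<in> carrier Cr"
      using c c' by (intro Cr.m_closed) (auto simp: Cr_def)
    moreover have "c' \<circ>\<^sub>r (\<theta> \<circ>\<^sub>r c) = \<phi>"
      using \<phi>(1) dom by (simp add: \<theta>_def ratmap_comp_assoc dominant_comp cancel cc ratmap_comp_id_right)
    ultimately show False using \<phi>(2) by (simp add: Cr_def)
  qed
  moreover have "\<theta> \<circ>\<^sub>r (c \<circ>\<^sub>r h \<circ>\<^sub>r c') = (c \<circ>\<^sub>r h \<circ>\<^sub>r c') \<circ>\<^sub>r \<theta>" if h: "h \<in> H" for h
  proof -
    have dh: "dominant h" using h H(2) by (auto simp: Cr_def birational_def)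
    have "\<phi> \<circ>\<^sub>r (h \<circ>\<^sub>r c') = h \<circ>\<^sub>r (\<phi> \<circ>\<^sub>r c')"
      using \<phi>(3)[OF h] \<phi>(1) dom dh by (simp flip: ratmap_comp_assoc)
    then show ?thesis
      using \<phi>(1) dom dh by (simp add: \<theta>_def ratmap_comp_assoc dominant_comp cancel)
  qed
  moreover have "\<alpha> \<otimes>\<^bsub>Cr\<^esub> \<beta> = \<alpha> \<circ>\<^sub>r \<beta>" for \<alpha> \<beta> :: "('a, 'n) ratmap" by (simp add: Cr_def)
  ultimately show ?thesis
    unfolding nontrivially_self_compressible_def c'_def by (intro exI[of _ \<theta>]) auto
qed

theorem corollary2p9:
  fixes G :: "('a::{alg_closed_field, field_char_0}, 'n::finite) ratmap set"
  assumes "subgroup G Cr" and "finite G"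
    and "\<exists>c\<in>carrier Cr. \<exists>H. subgroup H Cr \<and> H \<subseteq> GL \<and>
           G = (\<lambda>h. c \<otimes>\<^bsub>Cr\<^esub> h \<otimes>\<^bsub>Cr\<^esub> inv\<^bsub>Cr\<^esub> c) ` H"
  shows "nontrivially_self_compressible G"
proof -
  interpret Cr: group "Cr :: ('a, 'n) ratmap monoid" by (rule group_Cr)
  obtain c H where c: "c \<in> carrier Cr" and H: "subgroup H Cr" "H \<subseteq> GL"
    and G: "G = (\<lambda>h. c \<otimes>\<^bsub>Cr\<^esub> h \<otimes>\<^bsub>Cr\<^esub> inv\<^bsub>Cr\<^esub> c) ` H"
    using assms(3) by blast
  have carr: "H \<subseteq> carrier Cr" by (rule subgroup.subset[OF H(1)])
  \<comment> \<open>Finiteness is given for \<open>G\<close>; it passes to \<open>H\<close> because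
    conjugation is injective.\<close>
  then have "inj_on (\<lambda>h. c \<otimes>\<^bsub>Cr\<^esub> h \<otimes>\<^bsub>Cr\<^esub> inv\<^bsub>Cr\<^esub> c) H"
    using c by (intro inj_onI) (auto simp: subset_iff)
  then have "finite H" using assms(2) G finite_imageD by blast
  then show ?thesis
    unfolding G using nontrivially_self_compressible_conj[OF _ carr c]
      nontrivially_self_compressible_finite_linear[OF H] by blast
qed

end
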